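(* For every integer $n\ge 3$, $|B_n(213,312,321)|=n$.
   Context: A permutation $\sigma\in S_n$ is written as $\sigma(1)\cdots\sigma(n)$. An index $i\in[n-1]$ is an ascent if $\sigma(i)<\sigma(i+1)$ and a descent if $\sigma(i)>\sigma(i+1)$. A ballot permutation is a permutation such that every prefix $\sigma(1)\cdots\sigma(p)$ has at least as many ascents as descents. $\sigma$ contains a pattern $\pi\in S_k$ if some subsequence $\sigma(c_1)\cdots\sigma(c_k)$ with $c_1<\dots<c_k$ is order-isomorphic to $\pi$, and avoids $\pi$ otherwise. $B_n(\pi_1,\dots,\pi_m)$ denotes the set of ballot permutations of length $n$ avoiding all of $\pi_1,\dots,\pi_m$. *)

theory Defs
  imports "HOL-Combinatorics.Multiset_Permutations" "HOL-Library.Sublist"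
begin

text \<open>
  A permutation of \<open>{1..n}\<close> is represented by its word \<open>[\<sigma>(1), \<dots>, \<sigma>(n)]\<close>, an element of
  \<^term>\<open>permutations_of_set {1..n}\<close>. List positions start at 0, so position \<open>i\<close> of the word
  holds \<open>\<sigma>(i + 1)\<close>.
\<close>

definition ascents :: "nat list \<Rightarrow> nat set" where
  "ascents xs = {i. Suc i < length xs \<and> xs ! i < xs ! Suc i}"

definition descents :: "nat list \<Rightarrow> nat set" where
  "descents xs = {i. Suc i < length xs \<and> xs ! i > xs ! Suc i}"

definition ballot :: "nat list \<Rightarrow> bool" where
  "ballot xs \<longleftrightarrow> (\<forall>ys. prefix ys xs \<longrightarrow> card (ascents ys) \<ge> card (descents ys))"

definition order_isomorphic :: "nat list \<Rightarrow> nat list \<Rightarrow> bool" where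
  "order_isomorphic xs ys \<longleftrightarrow> length xs = length ys \<and>
     (\<forall>i < length xs. \<forall>j < length xs. xs ! i < xs ! j \<longleftrightarrow> ys ! i < ys ! j)"

definition contains_pattern :: "nat list \<Rightarrow> nat list \<Rightarrow> bool" where
  "contains_pattern xs p \<longleftrightarrow> (\<exists>ys. subseq ys xs \<and> order_isomorphic ys p)"

abbreviation avoids_pattern :: "nat list \<Rightarrow> nat list \<Rightarrow> bool" where
  "avoids_pattern xs p \<equiv> \<not> contains_pattern xs p"

definition ballot_avoiders :: "nat \<Rightarrow> nat list set \<Rightarrow> nat list set" where
  "ballot_avoiders n P =
     {xs \<in> permutations_of_set {1..n}. ballot xs \<and> (\<forall>p \<in> P. avoids_pattern xs p)}"

end

theory Submission
  imports Defs
begin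

text \<open>
  The patterns 213, 312, 321 are exactly the three words of length 3 whose first entry exceeds the
  second, so a word avoids all of them iff it increases up to its last but one entry. Such a
  permutation is determined by its last entry \<open>k\<close>. It has at most one descent, in the last
  position, and for \<open>n \<ge> 3\<close> it starts with an ascent, so it is ballot. Hence there
  are \<open>n\<close> choices.
\<close>

lemma subseq_pair_Cons_iff:
  "subseq [a, b] (x # xs) \<longleftrightarrow> a = x \<and> b \<in> set xs \<or> subseq [a, b] xs"
  by (auto simp: subseq_singleton_left dest: list_emb_set subseq_Cons')

text \<open>Both sides obey the same recursion: the head is related to every later entry, and the
  tail again satisfies the condition. This puts monotonicity in the language of pattern
  containment.\<close>

lemma sorted_wrt_iff_subseq:
  "sorted_wrt R xs \<longleftrightarrow> (\<forall>a b. subseq [a, b] xs \<longrightarrow> R a b)"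
  by (induction xs) (auto simp: subseq_pair_Cons_iff simp del: subseq_Cons2_iff)

lemma subseq_snocD:
  assumes "subseq (xs @ [x]) (ys @ [y])"
  shows "subseq xs ys"
proof -
  obtain us vs where uv: "ys @ [y] = us @ vs" "subseq xs us" "subseq [x] vs"
    using list_emb_appendD[OF assms] by blast
  \<comment> \<open>\<open>vs\<close> contains \<open>x\<close>, so it is nonempty and ends in
    \<open>y\<close>; hence \<open>us\<close> stops before that final \<open>y\<close>.\<close>
  then have "prefix us ys"
    by (cases vs rule: rev_cases) (auto simp: append_assoc[symmetric] simp del: append_assoc)
  then show ?thesis
    using uv(2) by (auto simp: prefix_def)
qed

lemma order_isomorphic_triple:
  "order_isomorphic [a, b, c] [p, q, r] \<longleftrightarrow>
     (a < b \<longleftrightarrow> p < q) \<and> (b < a \<longleftrightarrow> q < p) \<and> (a < c \<longleftrightarrow> p < r)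
       \<and> (c < a \<longleftrightarrow> r < p) \<and> (b < c \<longleftrightarrow> q < r) \<and> (c < b \<longleftrightarrow> r < q)"
  by (simp add: order_isomorphic_def All_less_Suc2 conj_ac)

lemma order_isomorphic_tripleE:
  assumes "order_isomorphic ys [p, q, r]"
  obtains a b c where "ys = [a, b, c]"
proof -
  have "length ys = Suc (Suc (Suc 0))"
    using assms by (simp add: order_isomorphic_def)
  then show ?thesis
    using that by (auto simp only: length_Suc_conv length_0_conv)
qed

lemma avoids_213_312_321_iff:
  assumes "distinct (zs @ [z])"
  shows "(\<forall>p \<in> {[2, 1, 3], [3, 1, 2], [3, 2, 1]}. avoids_pattern (zs @ [z]) p)
           \<longleftrightarrow> sorted_wrt (<) zs"
proof
  assume avoids: "\<forall>p \<in> {[2, 1, 3], [3, 1, 2], [3, 2, 1]}. avoids_pattern (zs @ [z]) p"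
  show "sorted_wrt (<) zs"
    unfolding sorted_wrt_iff_subseq
  proof (intro allI impI, rule ccontr)
    fix a b
    assume ab: "subseq [a, b] zs" "\<not> a < b"
    have sub: "subseq [a, b, z] (zs @ [z])"
      using list_emb_append_mono[OF ab(1), of "[z]" "[z]"] by simp
    have "distinct [a, b, z]"
      using sub assms subseqs_distinctD by fastforce
    \<comment> \<open>The last entry \<open>z\<close> completes the decreasing pair to a pattern:
      321 if \<open>z\<close> is below both, 312 if between, 213 if above both.\<close>
    with ab(2) have "b < a" "z < b \<or> b < z \<and> z < a \<or> a < z"
      by auto
    then have "order_isomorphic [a, b, z] [2, 1, 3] \<or> order_isomorphic [a, b, z] [3, 1, 2]
        \<or> order_isomorphic [a, b, z] [3, 2, 1]"
      by (auto simp: order_isomorphic_triple)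
    with sub avoids show False
      unfolding contains_pattern_def by blast
  qed
next
  assume sorted: "sorted_wrt (<) zs"
  show "\<forall>p \<in> {[2, 1, 3], [3, 1, 2], [3, 2, 1]}. avoids_pattern (zs @ [z]) p"
  proof (intro ballI notI)
    fix p :: "nat list"
    assume p: "p \<in> {[2, 1, 3], [3, 1, 2], [3, 2, 1]}" and "contains_pattern (zs @ [z]) p"
    then obtain ys where ys: "subseq ys (zs @ [z])" "order_isomorphic ys p"
      unfolding contains_pattern_def by blast
    obtain a b c where abc: "ys = [a, b, c]"
      using ys(2) p by (auto elim: order_isomorphic_tripleE)
    \<comment> \<open>Whichever entry plays \<open>c\<close>, the first two entries of an occurrence
      lie strictly before the last position.\<close>
    have "subseq [a, b] zs"
      using ys(1) abc subseq_snocD[of "[a, b]" c zs z] by simp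
    then have "a < b"
      using sorted unfolding sorted_wrt_iff_subseq by blast
    then show False
      using ys(2) p abc by (auto simp: order_isomorphic_triple)
  qed
qed

lemma finite_ascents: "finite (ascents xs)"
  by (rule finite_subset[of _ "{..<length xs}"]) (auto simp: ascents_def)

lemma descents_strict_sorted:
  assumes "sorted_wrt (<) xs"
  shows "descents xs = {}"
  using sorted_wrt_nth_less[OF assms] by (fastforce simp: descents_def)

lemma ballot_strict_sorted_snoc:
  assumes sorted: "sorted_wrt (<) zs" and len: "length zs \<ge> 2"
  shows "ballot (zs @ [z])"
  unfolding ballot_def
proof (intro allI impI)
  fix ys
  assume "prefix ys (zs @ [z])"
  then consider "ys = zs @ [z]" | "prefix ys zs"
    by auto
  then show "card (descents ys) \<le> card (ascents ys)"
  proof cases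
    case 1
    \<comment> \<open>Counting from 0, this is the position of the last entry of \<open>zs\<close>,
      the only one whose successor is \<open>z\<close>.\<close>
    have "descents ys \<subseteq> {length zs - 1}"
    proof
      fix i
      assume i: "i \<in> descents ys"
      show "i \<in> {length zs - 1}"
      proof (cases "Suc i < length zs")
        case True
        then show ?thesis
          using i 1 sorted_wrt_nth_less[OF sorted, of i "Suc i"]
          by (auto simp: descents_def nth_append)
      next
        case False
        then show ?thesis
          using i 1 by (auto simp: descents_def)
      qed
    qed
    then have "card (descents ys) \<le> 1"
      using card_mono[of "{length zs - 1}"] by fastforce
    moreover have "0 \<in> ascents ys"
      using 1 len sorted_wrt_nth_less[OF sorted, of 0 1]
      by (auto simp: ascents_def nth_append)
    \<comment> \<open>Finiteness matters here: \<open>card\<close> of an infinite set is 0.\<close>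
    then have "card (ascents ys) \<ge> 1"
      using finite_ascents[of ys] by (auto simp: Suc_le_eq card_gt_0_iff)
    ultimately show ?thesis
      by simp
  next
    case 2
    then have "sorted_wrt (<) ys"
      using sorted by (auto simp: prefix_def sorted_wrt_append)
    then show ?thesis
      by (simp add: descents_strict_sorted)
  qed
qed

lemma ballot_avoiders_213_312_321:
  assumes "n \<ge> 3"
  shows "ballot_avoiders n {[2, 1, 3], [3, 1, 2], [3, 2, 1]} =
           (\<lambda>k. sorted_list_of_set ({1..n} - {k}) @ [k]) ` {1..n}"
    (is "?B = ?w ` _")
proof (intro equalityI subsetI)
  fix xs
  assume xs: "xs \<in> ?B"
  then have perm: "set xs = {1..n}" "distinct xs"
    by (auto simp: ballot_avoiders_def permutations_of_set_def)
  with assms have "xs \<noteq> []"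
    by auto
  then obtain zs z where zs: "xs = zs @ [z]"
    by (metis append_butlast_last_id)
  have "\<forall>p \<in> {[2, 1, 3], [3, 1, 2], [3, 2, 1]}. avoids_pattern (zs @ [z]) p"
    using xs zs by (simp add: ballot_avoiders_def)
  then have "sorted_wrt (<) zs"
    using avoids_213_312_321_iff perm(2) zs by blast
  moreover have "set zs = {1..n} - {z}"
    using perm zs by auto
  \<comment> \<open>A strictly increasing list is determined by its set of entries.\<close>
  ultimately have "zs = sorted_list_of_set ({1..n} - {z})"
    by (metis sorted_list_of_set.idem_if_sorted_distinct strict_sorted_iff)
  moreover have "z \<in> {1..n}"
    using perm(1) zs by auto
  ultimately show "xs \<in> ?w ` {1..n}"
    using zs by blast
next
  fix xs
  assume "xs \<in> ?w ` {1..n}"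
  then obtain k where k: "k \<in> {1..n}" "xs = ?w k"
    by blast
  define zs where "zs = sorted_list_of_set ({1..n} - {k})"
  have zs: "sorted_wrt (<) zs" "set zs = {1..n} - {k}"
    by (simp_all add: zs_def)
  \<comment> \<open>The length is \<open>n - 1\<close>, so \<open>n \<ge> 3\<close> guarantees the
    initial ascent that pays for a final descent.\<close>
  have len: "length zs \<ge> 2"
    using k(1) assms by (simp add: zs_def)
  have dist: "distinct (zs @ [k])"
    using zs by (simp add: strict_sorted_iff)
  have "set (zs @ [k]) = {1..n}"
    unfolding set_append zs(2) using k(1) by auto
  then have "zs @ [k] \<in> permutations_of_set {1..n}"
    using dist by (rule permutations_of_setI)
  moreover have "ballot (zs @ [k])"
    by (rule ballot_strict_sorted_snoc[OF zs(1) len])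
  moreover have "\<forall>p \<in> {[2, 1, 3], [3, 1, 2], [3, 2, 1]}. avoids_pattern (zs @ [k]) p"
    using zs(1) by (rule iffD2[OF avoids_213_312_321_iff[OF dist]])
  ultimately have "zs @ [k] \<in> ?B"
    unfolding ballot_avoiders_def mem_Collect_eq by (intro conjI)
  then show "xs \<in> ?B"
    using k(2) by (simp add: zs_def)
qed

theorem theorem4p7:
  fixes n :: nat
  assumes "n \<ge> 3"
  shows "card (ballot_avoiders n {[2, 1, 3], [3, 1, 2], [3, 2, 1]}) = n"
proof -
  \<comment> \<open>The parameter \<open>k\<close> can be read off as the last entry of the
    word.\<close>
  have "inj_on (\<lambda>k. sorted_list_of_set ({1..n} - {k}) @ [k]) {1..n}"
    by (rule inj_onI) simp
  then show ?thesis
    unfolding ballot_avoiders_213_312_321[OF assms] by (simp add: card_image)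
qed

end
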